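(* Let $p(\cdot)\in\mathcal S$ with $p_+<\infty$, $p_->1$ and $p(\cdot)\in LH_\infty(\mathbb Z)$. Then there is a constant $C>0$, not depending on $a$, such that for every non-negative sequence $a=\{a(i)\}_{i\in\mathbb Z}\in\ell^{p(\cdot)}(\mathbb Z)$, $$\|Ma\|_{\ell^{p(\cdot)}(\mathbb Z)}\le C\,\|a\|_{\ell^{p(\cdot)}(\mathbb Z)}.$$
   Context: $\mathcal S$ is the set of bounded sequences $p(\cdot)=\{p(n)\}_{n\in\mathbb Z}$ with values in $[1,\infty)$; $p_-=\inf_n p(n)$ and $p_+=\sup_n p(n)<\infty$. For $p(\cdot)\in\mathcal S$ the modular is $\rho_{p(\cdot)}(a)=\sum_{k\in\mathbb Z}|a(k)|^{p(k)}$; $\ell^{p(\cdot)}(\mathbb Z)$ is the set of real sequences $a$ on $\mathbb Z$ such that $\rho_{p(\cdot)}(a/\lambda)<\infty$ for some $\lambda>0$, with norm $\|a\|_{\ell^{p(\cdot)}(\mathbb Z)}=\inf\{\lambda>0:\rho_{p(\cdot)}(a/\lambda)\le1\}$. A sequence $p(\cdot)$ is log-Hölder continuous at infinity, written $p(\cdot)\in LH_\infty(\mathbb Z)$, if there are positive real constants $C_\infty,p_\infty$ such that $|p(n)-p_\infty|\le \frac{C_\infty}{\log(e+|n|)}$ for all $n\in\mathbb Z$. The Hardy–Littlewood maximal operator is $Ma(n)=\sup_{I\ni n}\frac1{|I|}\sum_{k\in I}|a(k)|$, where the supremum is over all (finite) intervals $I$ of integers containing $n$ and $|I|$ is the cardinality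 of $I$. *)

theory Defs
  imports "HOL-Analysis.Analysis"
begin

definition exponents :: "(int \<Rightarrow> real) set" where
  "exponents = {p. (\<forall>n. 1 \<le> p n) \<and> bounded (range p)}"

definition exp_minus :: "(int \<Rightarrow> real) \<Rightarrow> ereal" where
  "exp_minus p = (INF n. ereal (p n))"

definition exp_plus :: "(int \<Rightarrow> real) \<Rightarrow> ereal" where
  "exp_plus p = (SUP n. ereal (p n))"

definition LH_infinity :: "(int \<Rightarrow> real) set" where
  "LH_infinity = {p. \<exists>C p_inf. 0 < C \<and> 0 < p_inf \<and>
     (\<forall>n. \<bar>p n - p_inf\<bar> \<le> C / ln (exp 1 + \<bar>real_of_int n\<bar>))}"

definition modular :: "(int \<Rightarrow> real) \<Rightarrow> (int \<Rightarrow> real) \<Rightarrow> ennreal" where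
  "modular p a = (\<Sum>\<^sub>\<infinity>k\<in>UNIV. ennreal (\<bar>a k\<bar> powr p k))"

definition var_lp :: "(int \<Rightarrow> real) \<Rightarrow> (int \<Rightarrow> real) set" where
  "var_lp p = {a. \<exists>t>0. modular p (\<lambda>k. a k / t) < \<infinity>}"

(* Meaningful only for a \<in> var_lp p: outside that space the set below is empty
   and its real infimum carries no information. *)
definition var_lp_norm :: "(int \<Rightarrow> real) \<Rightarrow> (int \<Rightarrow> real) \<Rightarrow> real" where
  "var_lp_norm p a = Inf {t. 0 < t \<and> modular p (\<lambda>k. a k / t) \<le> 1}"

definition intervals_around :: "int \<Rightarrow> int set set" where
  "intervals_around n = {I. n \<in> I \<and> (\<exists>l u. I = {l..u})}"

(* The real-valued supremum is the true one as soon as the averages are bounded;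
   var_lp_maximal_bdd_above shows that this holds on var_lp p. *)
definition maximal :: "(int \<Rightarrow> real) \<Rightarrow> int \<Rightarrow> real" where
  "maximal a n = (SUP I\<in>intervals_around n. (\<Sum>k\<in>I. \<bar>a k\<bar>) / real (card I))"

lemma var_lp_bounded:
  assumes p: "p \<in> exponents" and a: "a \<in> var_lp p"
  obtains B where "\<And>k. \<bar>a k\<bar> \<le> B"
proof -
  obtain l where l: "l > 0" and fin: "modular p (\<lambda>k. a k / l) < \<infinity>"
    using a by (auto simp: var_lp_def)
  define R where "R = enn2real (modular p (\<lambda>k. a k / l))"
  have R: "ennreal R = modular p (\<lambda>k. a k / l)"
    using fin by (simp add: R_def)
  have "\<bar>a k\<bar> \<le> l * max 1 R" for k
  proof -
    let ?x = "\<bar>a k / l\<bar>"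
    have "(\<Sum>\<^sub>\<infinity>i\<in>{k}. ennreal (\<bar>a i / l\<bar> powr p i)) \<le> ennreal R"
      unfolding R modular_def
      by (rule infsum_mono_neutral) (auto intro: nonneg_summable_on_complete)
    then have le: "?x powr p k \<le> R"
      by (simp add: R_def)
    have "?x \<le> max 1 R"
    proof (cases "?x \<le> 1")
      case False
      then have "?x powr 1 \<le> ?x powr p k"
        using p by (intro powr_mono) (auto simp: exponents_def)
      with le False show ?thesis by simp
    qed simp
    then show ?thesis
      using l by (simp add: field_simps)
  qed
  then show ?thesis by (rule that)
qed

lemma var_lp_maximal_bdd_above:
  assumes "p \<in> exponents" and "a \<in> var_lp p"
  shows "bdd_above ((\<lambda>I. (\<Sum>k\<in>I. \<bar>a k\<bar>) / real (card I)) ` intervals_around n)"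
proof -
  obtain B where B: "\<And>k. \<bar>a k\<bar> \<le> B"
    using var_lp_bounded[OF assms] by blast
  have "(\<Sum>k\<in>I. \<bar>a k\<bar>) / real (card I) \<le> B" if "I \<in> intervals_around n" for I
  proof -
    have "finite I" "I \<noteq> {}"
      using that by (auto simp: intervals_around_def)
    then have "card I > 0" by (simp add: card_gt_0_iff)
    moreover have "(\<Sum>k\<in>I. \<bar>a k\<bar>) \<le> real (card I) * B"
      by (rule sum_bounded_above) (rule B)
    ultimately show ?thesis by (simp add: field_simps)
  qed
  then show ?thesis by (intro bdd_aboveI2)
qed

end

theory Submission
  imports Defs
begin

text \<open>
  If \<open>\<rho>(a) \<le> 1\<close> then \<open>a \<le> 1\<close>, and hence \<open>Ma \<le> 1\<close>. For values in \<open>[0, 1]\<close> the log-Hoelder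
  condition lets one exchange the exponent \<open>p(k)\<close> for the constant \<open>q = p\<^sub>\<infinity>\<close>, at the cost of a
  factor and of the summable error \<open>(e + |k|)\<^sup>-\<^sup>2\<close>. Doing this once for \<open>a\<close> and once, backwards, for
  \<open>Ma\<close> reduces the claim to the boundedness of \<open>M\<close> on \<open>\<ell>\<^sup>q\<close>, where \<open>q \<ge> p\<^sub>- > 1\<close>. There \<open>M\<close> is at
  most the sum of its two one-sided versions, whose weak-type inequality is the rising sun lemma
  and whose strong-type inequality follows by integrating over the levels. Replacing \<open>Ma\<close> by the
  averages over near-optimal intervals keeps all sums finite.
\<close>

section \<open>Exchanging exponents under log-Hoelder continuity\<close>

text \<open>If \<open>x > y powr - 2\<close>, then \<open>- ln x\<close> is at most
  \<open>2 * ln y\<close>, so moving the exponent by \<open>C / ln y\<close> costs at most the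
  factor \<open>exp (2 * C)\<close>. A smaller \<open>x\<close> is absorbed by the error term,
  because \<open>s \<ge> 1\<close>. Only the target exponent \<open>s\<close> has to be at least
  1.\<close>

lemma powr_le_exponent_perturbed:
  fixes x y r s C :: real
  assumes "0 \<le> x" "x \<le> 1" "1 \<le> s" "1 < y" "\<bar>r - s\<bar> \<le> C / ln y"
  shows "x powr s \<le> exp (2 * C) * x powr r + y powr - 2"
proof (cases "x \<le> y powr - 2")
  case True
  have "x powr s \<le> x powr 1"
    using assms by (intro powr_mono') auto
  also have "\<dots> = x" using assms(1) by simp
  finally have "x powr s \<le> x" .
  moreover have "0 \<le> exp (2 * C) * x powr r" by simp
  ultimately show ?thesis using True by linarith
next
  case False
  have y: "0 < ln y" using assms by simp
  have x: "0 < x" using False by (meson less_le_trans not_le powr_ge_zero)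
  have "ln (y powr - 2) \<le> ln x"
    using False assms x by (subst ln_le_cancel_iff) auto
  then have l: "- ln x \<le> 2 * ln y" using assms by (simp add: ln_powr)
  have l0: "0 \<le> - ln x" using x assms by simp
  have "(s - r) * ln x \<le> \<bar>r - s\<bar> * (- ln x)"
    using l0 by (metis abs_ge_minus_self abs_minus_commute minus_diff_eq minus_mult_minus
        minus_minus mult_right_mono)
  also have "\<dots> \<le> (C / ln y) * (2 * ln y)"
    using assms(5) l l0 by (intro mult_mono) auto
  also have "\<dots> = 2 * C" using y by simp
  finally have "x powr (s - r) \<le> exp (2 * C)"
    using x by (simp add: powr_def)
  then have "x powr r * x powr (s - r) \<le> x powr r * exp (2 * C)"
    by (intro mult_left_mono) auto
  then have "x powr s \<le> exp (2 * C) * x powr r"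
    using x by (simp add: powr_add[symmetric] mult.commute)
  moreover have "0 \<le> y powr - 2" by simp
  ultimately show ?thesis by linarith
qed

text \<open>Bounds the total error of an exchange of exponents. The absolute value is injective on
  each half-line, so two copies of the series of inverse squares dominate.\<close>

lemma sum_inverse_square_int_bounded:
  obtains S :: real where "0 \<le> S"
    "\<And>F. finite F \<Longrightarrow> (\<Sum>k\<in>F. (exp 1 + \<bar>real_of_int k\<bar>) powr - 2) \<le> S"
proof -
  define g where "g n = inverse ((real (Suc n))\<^sup>2)" for n
  have sm: "summable g"
    unfolding g_def using inverse_power_summable[of 2, where 'a = real]
    by (subst summable_Suc_iff) (simp add: power_inverse)
  have g0: "0 \<le> g n" for n by (simp add: g_def)
  have le: "(exp 1 + \<bar>real_of_int k\<bar>) powr - 2 \<le> g (nat \<bar>k\<bar>)" for k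
  proof -
    have "(1::real) \<le> exp 1" by simp
    then have "1 + \<bar>real_of_int k\<bar> \<le> exp 1 + \<bar>real_of_int k\<bar>" by simp
    then have "(exp 1 + \<bar>real_of_int k\<bar>) powr - 2 \<le> (1 + \<bar>real_of_int k\<bar>) powr - 2"
      by (intro powr_mono2') auto
    also have "\<dots> = g (nat \<bar>k\<bar>)"
      by (simp add: g_def powr_minus of_nat_nat add.commute)
    finally show ?thesis .
  qed
  have part: "(\<Sum>k\<in>G. g (nat \<bar>k\<bar>)) \<le> suminf g" if "finite G" "inj_on (\<lambda>k. nat \<bar>k\<bar>) G" for G
    using sum_le_suminf[OF sm, of "(\<lambda>k. nat \<bar>k\<bar>) ` G"] that g0
    by (simp add: sum.reindex)
  show ?thesis
  proof (rule that[of "2 * suminf g"])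
    show "0 \<le> 2 * suminf g" using suminf_nonneg[OF sm] g0 by simp
    fix F :: "int set" assume F: "finite F"
    let ?P = "{k\<in>F. 0 \<le> k}" and ?N = "{k\<in>F. k < 0}"
    have "(\<Sum>k\<in>F. (exp 1 + \<bar>real_of_int k\<bar>) powr - 2) \<le> (\<Sum>k\<in>F. g (nat \<bar>k\<bar>))"
      by (intro sum_mono le)
    also have "\<dots> = (\<Sum>k\<in>?P \<union> ?N. g (nat \<bar>k\<bar>))"
      by (rule sum.cong) auto
    also have "\<dots> = (\<Sum>k\<in>?P. g (nat \<bar>k\<bar>)) + (\<Sum>k\<in>?N. g (nat \<bar>k\<bar>))"
      using F by (intro sum.union_disjoint) auto
    also have "\<dots> \<le> suminf g + suminf g"
      using F by (intro add_mono part) (auto simp: inj_on_def)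
    finally show "(\<Sum>k\<in>F. (exp 1 + \<bar>real_of_int k\<bar>) powr - 2) \<le> 2 * suminf g" by simp
  qed
qed

section \<open>Weak-type and strong-type bounds for a constant exponent\<close>

text \<open>A discrete rising sun lemma: a point outside the set has negative value, so deleting
  such points from an interval of nonnegative sum can only increase the sum.\<close>

lemma rising_sun_sum_nonneg:
  fixes b :: "int \<Rightarrow> real"
  shows "0 \<le> (\<Sum>n | n \<in> {L..u} \<and> (\<exists>m\<in>{L..n}. 0 \<le> sum b {m..n}). b n)"
proof (induction "nat (u - L + 1)" arbitrary: u rule: less_induct)
  case less
  \<comment> \<open>\<open>E\<close> does not depend on the right end \<open>u\<close>, so the same
    set serves in the induction hypothesis for shorter intervals.\<close>
  define E where "E = {n. \<exists>m\<in>{L..n}. 0 \<le> sum b {m..n}}"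
  have eq: "{n. n \<in> {L..v} \<and> (\<exists>m\<in>{L..n}. 0 \<le> sum b {m..n})} = {L..v} \<inter> E" for v
    by (auto simp: E_def)
  have IH: "0 \<le> sum b ({L..v} \<inter> E)" if "v < u" "L \<le> u" for v
    using less[of v] that unfolding eq by simp
  have neg: "b n \<le> 0" if "n \<notin> E" "L \<le> n" for n
  proof (rule ccontr)
    assume "\<not> b n \<le> 0"
    then have "0 \<le> sum b {n..n}" by simp
    then show False using that by (auto simp: E_def dest: bspec[of _ _ n])
  qed
  show ?case unfolding eq
  proof (cases "L \<le> u")
    case Lu: True
    show "0 \<le> sum b ({L..u} \<inter> E)"
    proof (cases "u \<in> E")
      case True
      then obtain m where m: "L \<le> m" "m \<le> u" "0 \<le> sum b {m..u}" by (auto simp: E_def)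
      \<comment> \<open>The block from \<open>m\<close> to \<open>u\<close> has nonnegative sum,
        which survives deleting the nonpositive terms outside \<open>E\<close>. What remains to its
        left is a shorter interval.\<close>
      have "sum b {m..u} = sum b ({m..u} \<inter> E) + sum b ({m..u} - E)"
        by (rule sum.Int_Diff) simp
      moreover have "sum b ({m..u} - E) \<le> 0"
        using m by (intro sum_nonpos) (auto intro: neg)
      ultimately have "0 \<le> sum b ({m..u} \<inter> E)" using m by linarith
      moreover have "0 \<le> sum b ({L..m - 1} \<inter> E)" using m by (intro IH) auto
      moreover have "{L..u} \<inter> E = ({L..m - 1} \<inter> E) \<union> ({m..u} \<inter> E)" using m by auto
      moreover have "sum b (({L..m - 1} \<inter> E) \<union> ({m..u} \<inter> E))
          = sum b ({L..m - 1} \<inter> E) + sum b ({m..u} \<inter> E)"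
        by (rule sum.union_disjoint) auto
      ultimately show ?thesis by simp
    next
      case False
      then have "{L..u} \<inter> E = {L..u - 1} \<inter> E"
        by (auto simp: order_less_le)
      then show ?thesis using IH[of "u - 1"] Lu by simp
    qed
  qed simp
qed

text \<open>Integrate the weak-type hypothesis against \<open>\<lambda>\<^bsup>q-2\<^esup>\<close>.\<close>

lemma weak_type_imp_sum_powr_le:
  fixes A a :: "'i \<Rightarrow> real"
  assumes X: "finite X" and A: "\<And>n. n \<in> X \<Longrightarrow> 0 \<le> A n" and q: "1 < q"
    and weak: "\<And>t. 0 < t \<Longrightarrow> 0 \<le> (\<Sum>n | n \<in> X \<and> t \<le> A n. a n - t)"
  shows "(\<Sum>n\<in>X. A n powr q) \<le> q / (q - 1) * (\<Sum>n\<in>X. a n * A n powr (q - 1))"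
proof -
  \<comment> \<open>Summed over \<open>X\<close>, this integrand is \<open>t powr (q - 2)\<close>
    times the sum in \<open>weak\<close>. The cutoff at \<open>A n\<close> encodes the level set,
    and integrability at 0 comes from \<open>q - 2 > -1\<close>.\<close>
  define h where "h n t = (if t \<in> {0..A n} then a n * t powr (q - 2) - t powr (q - 1) else 0)" for n t
  have "(h n has_integral (a n * (A n powr (q - 1) / (q - 1)) - A n powr q / q)) {0..}"
    if "n \<in> X" for n
  proof -
    have "((\<lambda>t. a n * t powr (q - 2) - t powr (q - 1)) has_integral
        (a n * (A n powr (q - 2 + 1) / (q - 2 + 1)) - A n powr (q - 1 + 1) / (q - 1 + 1))) {0..A n}"
      using q A[OF that]
      by (intro has_integral_diff has_integral_mult_right has_integral_powr_from_0) auto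
    then have "((\<lambda>t. a n * t powr (q - 2) - t powr (q - 1)) has_integral
        (a n * (A n powr (q - 1) / (q - 1)) - A n powr q / q)) {0..A n}" by simp
    then show ?thesis
      unfolding h_def by (subst has_integral_restrict) auto
  qed
  then have I: "((\<lambda>t. \<Sum>n\<in>X. h n t) has_integral
      (\<Sum>n\<in>X. a n * (A n powr (q - 1) / (q - 1)) - A n powr q / q)) {0..}"
    using X by (intro has_integral_sum) auto
  have "0 \<le> (\<Sum>n\<in>X. h n t)" if t: "t \<in> {0..}" for t
  proof (cases "t = 0")
    case True
    \<comment> \<open>Holds for every \<open>q\<close> because \<open>0 powr x = 0\<close> for all
      \<open>x\<close>.\<close>
    then have "h n t = 0" for n by (simp add: h_def)
    then show ?thesis by simp
  next
    case False
    then have t: "0 < t" using t by simp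
    have "t powr (q - 1) = t powr (q - 2) * t"
      using t powr_add[of t "q - 2" 1] by simp
    then have "(\<Sum>n\<in>X. h n t) = (\<Sum>n\<in>X. if t \<le> A n then t powr (q - 2) * (a n - t) else 0)"
      using t by (intro sum.cong) (auto simp: h_def algebra_simps)
    also have "\<dots> = (\<Sum>n | n \<in> X \<and> t \<le> A n. t powr (q - 2) * (a n - t))"
      using X by (simp add: sum.inter_filter)
    also have "\<dots> = t powr (q - 2) * (\<Sum>n | n \<in> X \<and> t \<le> A n. a n - t)"
      by (simp add: sum_distrib_left)
    finally show ?thesis using weak[OF t] by simp
  qed
  then have "0 \<le> (\<Sum>n\<in>X. a n * (A n powr (q - 1) / (q - 1)) - A n powr q / q)"
    using I has_integral_nonneg by blast
  also have "\<dots> = (\<Sum>n\<in>X. a n * A n powr (q - 1)) / (q - 1) - (\<Sum>n\<in>X. A n powr q) / q"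
    by (simp add: sum_subtractf sum_divide_distrib)
  finally show ?thesis using q by (simp add: field_simps)
qed

text \<open>A Young-type splitting of the mixed product leaves half of the left-hand side on the
  right, where it can be absorbed since all sums are finite.\<close>

lemma weak_type_imp_strong_type:
  fixes A a :: "'i \<Rightarrow> real"
  assumes X: "finite X" and A: "\<And>n. n \<in> X \<Longrightarrow> 0 \<le> A n" and a: "\<And>n. n \<in> X \<Longrightarrow> 0 \<le> a n"
    and q: "1 < q"
    and weak: "\<And>t. 0 < t \<Longrightarrow> 0 \<le> (\<Sum>n | n \<in> X \<and> t \<le> A n. a n - t)"
  shows "(\<Sum>n\<in>X. A n powr q) \<le> 2 * (2 * (q / (q - 1))) powr q * (\<Sum>n\<in>X. a n powr q)"
proof -
  define c where "c = q / (q - 1)"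
  have c: "1 \<le> c" using q by (simp add: c_def)
  \<comment> \<open>If \<open>2 * c * x \<le> y\<close>, the product is at most half of
    \<open>y powr q\<close>; otherwise both factors are controlled by
    \<open>2 * c * x\<close>.\<close>
  have split: "c * (x * y powr (q - 1)) \<le> y powr q / 2 + (2 * c) powr q * x powr q"
    if "0 \<le> x" "0 \<le> y" for x y :: real
  proof (cases "2 * (c * x) \<le> y")
    case True
    have "c * x * y powr (q - 1) \<le> y / 2 * y powr (q - 1)"
      using True by (intro mult_right_mono) auto
    also have "y * y powr (q - 1) = y powr q"
      using that(2) powr_add[of y 1 "q - 1"] by (cases "y = 0") auto
    then have "y / 2 * y powr (q - 1) = y powr q / 2" by simp
    finally show ?thesis by (simp add: add_increasing2 mult.assoc)
  next
    case False
    define z where "z = 2 * c * x"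
    have z: "0 < z" "y \<le> z" using False that by (auto simp: z_def)
    have "c * x * y powr (q - 1) \<le> z * z powr (q - 1)"
      using z that c q by (intro mult_mono powr_mono2) (auto simp: z_def)
    also have "\<dots> = z powr q" using z powr_add[of z 1 "q - 1"] by simp
    also have "\<dots> = (2 * c) powr q * x powr q"
      using c that by (simp add: z_def powr_mult)
    finally show ?thesis by (simp add: add_increasing mult.assoc)
  qed
  have "(\<Sum>n\<in>X. A n powr q) \<le> c * (\<Sum>n\<in>X. a n * A n powr (q - 1))"
    unfolding c_def by (rule weak_type_imp_sum_powr_le[OF X A q weak])
  also have "\<dots> = (\<Sum>n\<in>X. c * (a n * A n powr (q - 1)))" by (simp add: sum_distrib_left)
  also have "\<dots> \<le> (\<Sum>n\<in>X. A n powr q / 2 + (2 * c) powr q * a n powr q)"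
    using A a by (intro sum_mono split) auto
  also have "\<dots> = (\<Sum>n\<in>X. A n powr q) / 2 + (2 * c) powr q * (\<Sum>n\<in>X. a n powr q)"
    by (simp add: sum.distrib sum_divide_distrib sum_distrib_left)
  finally show ?thesis by (simp add: c_def)
qed

text \<open>Let \<open>A n\<close> be the largest average over intervals ending at \<open>n\<close>
  and starting at \<open>L\<close> or later. Its level set at \<open>t\<close> is exactly the set of
  the rising sun lemma for \<open>a - t\<close>, which yields the weak-type hypothesis.\<close>

lemma left_averages_strong_type:
  fixes a :: "int \<Rightarrow> real"
  assumes a: "\<And>k. 0 \<le> a k" and q: "1 < q" and m: "\<And>n. n \<in> {L..u} \<Longrightarrow> m n \<in> {L..n}"
  shows "(\<Sum>n\<in>{L..u}. (sum a {m n..n} / card {m n..n}) powr q)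
    \<le> 2 * (2 * (q / (q - 1))) powr q * (\<Sum>n\<in>{L..u}. a n powr q)"
proof -
  define A where "A n = Max ((\<lambda>m. sum a {m..n} / card {m..n}) ` {L..n})" for n
  have ge: "sum a {j..n} / card {j..n} \<le> A n" if "j \<in> {L..n}" for j n
    unfolding A_def using that by (intro Max_ge) auto
  have av0: "0 \<le> sum a {j..n} / card {j..n}" for j n
    using a by (simp add: sum_nonneg)
  have A0: "0 \<le> A n" if "n \<in> {L..u}" for n
    using order_trans[OF av0 ge[of n n]] that by simp
  have iff: "t \<le> A n \<longleftrightarrow> (\<exists>j\<in>{L..n}. 0 \<le> sum (\<lambda>k. a k - t) {j..n})" if "n \<in> {L..u}" for n t
  proof -
    have "t \<le> A n \<longleftrightarrow> (\<exists>j\<in>{L..n}. t \<le> sum a {j..n} / card {j..n})"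
      unfolding A_def using that by (subst Max_ge_iff) auto
    also have "\<dots> \<longleftrightarrow> (\<exists>j\<in>{L..n}. 0 \<le> sum (\<lambda>k. a k - t) {j..n})"
      by (intro bex_cong) (auto simp: sum_subtractf field_simps)
    finally show ?thesis .
  qed
  have "0 \<le> (\<Sum>n | n \<in> {L..u} \<and> t \<le> A n. a n - t)" for t
    using rising_sun_sum_nonneg[where b = "\<lambda>k. a k - t" and L = L and u = u] iff by (simp cong: conj_cong)
  then have "(\<Sum>n\<in>{L..u}. A n powr q) \<le> 2 * (2 * (q / (q - 1))) powr q * (\<Sum>n\<in>{L..u}. a n powr q)"
    using A0 a q by (intro weak_type_imp_strong_type) auto
  moreover have "(\<Sum>n\<in>{L..u}. (sum a {m n..n} / card {m n..n}) powr q) \<le> (\<Sum>n\<in>{L..u}. A n powr q)"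
    using q m by (intro sum_mono powr_mono2 ge av0) auto
  ultimately show ?thesis by linarith
qed

text \<open>Reflection of the integers at 0 reduces this to left averages.\<close>

lemma right_averages_strong_type:
  fixes a :: "int \<Rightarrow> real"
  assumes a: "\<And>k. 0 \<le> a k" and q: "1 < q" and m: "\<And>n. n \<in> {L..u} \<Longrightarrow> m n \<in> {n..u}"
  shows "(\<Sum>n\<in>{L..u}. (sum a {n..m n} / card {n..m n}) powr q)
    \<le> 2 * (2 * (q / (q - 1))) powr q * (\<Sum>n\<in>{L..u}. a n powr q)"
proof -
  have refl: "sum f {x..y} = sum (\<lambda>k. f (- k)) {- y..- x}" for f :: "int \<Rightarrow> real" and x y
    by (rule sum.reindex_bij_witness[of _ uminus uminus]) auto
  have "- m (- n) \<in> {- u..n}" if "n \<in> {- u..- L}" for n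
    using m[of "- n"] that by auto
  from left_averages_strong_type[where a = "\<lambda>k. a (- k)" and L = "- u" and u = "- L", OF a q this]
  show ?thesis
    by (simp add: refl[of _ L u] refl[of a] add_ac)
qed

text \<open>Counting \<open>n\<close> twice and shrinking the denominators can only increase the
  right-hand side, as \<open>a\<close> is nonnegative.\<close>

lemma average_le_left_right:
  fixes a :: "int \<Rightarrow> real"
  assumes a: "\<And>k. 0 \<le> a k" and "l \<le> n" "n \<le> u"
  shows "sum a {l..u} / card {l..u} \<le> sum a {l..n} / card {l..n} + sum a {n..u} / card {n..u}"
proof -
  have "sum a {l..u} \<le> sum a ({l..n} \<union> {n..u})"
    using a by (intro sum_mono2) auto
  also have "\<dots> \<le> sum a {l..n} + sum a {n..u}"
    using sum_Un[of "{l..n}" "{n..u}" a] sum_nonneg[of "{l..n} \<inter> {n..u}" a] a by simp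
  finally have "sum a {l..u} / card {l..u} \<le> sum a {l..n} / card {l..u} + sum a {n..u} / card {l..u}"
    by (simp add: divide_right_mono flip: add_divide_distrib)
  also have "\<dots> \<le> sum a {l..n} / card {l..n} + sum a {n..u} / card {n..u}"
    using assms by (intro add_mono divide_left_mono sum_nonneg) auto
  finally show ?thesis .
qed

text \<open>One-sided bounds apply on a bounded interval \<open>J\<close> holding \<open>F\<close>
  and all its chosen intervals. The factor \<open>2 powr q\<close> comes from the power of a sum of
  two terms, and 4 from the two sides times the 2 in the one-sided constant.\<close>

lemma averages_strong_type:
  fixes a :: "int \<Rightarrow> real"
  assumes a: "\<And>k. 0 \<le> a k" and q: "1 < q" and F: "finite F"
    and lu: "\<And>n. l n \<le> n" "\<And>n. n \<le> u n"
    and K: "\<And>G. finite G \<Longrightarrow> (\<Sum>k\<in>G. a k powr q) \<le> K"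
  shows "(\<Sum>n\<in>F. (sum a {l n..u n} / card {l n..u n}) powr q)
    \<le> 4 * 2 powr q * (2 * (q / (q - 1))) powr q * K"
proof -
  define X where "X = F \<union> l ` F \<union> u ` F"
  have "finite X" using F by (simp add: X_def)
  then obtain N where N: "\<And>x. x \<in> X \<Longrightarrow> \<bar>x\<bar> \<le> N"
    by (metis finite_imageI image_eqI Max_ge)
  define J where "J = {- N..N}"
  \<comment> \<open>Clipping to \<open>J\<close> makes the choice admissible at all points of
    \<open>J\<close>; at points of \<open>F\<close> it changes nothing.\<close>
  define l' where "l' n = max (- N) (l n)" for n
  define u' where "u' n = min N (u n)" for n
  define c where "c = 2 * (2 * (q / (q - 1))) powr q"
  define f where "f n = sum a {l' n..n} / card {l' n..n}" for n
  define g where "g n = sum a {n..u' n} / card {n..u' n}" for n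
  have fg0: "0 \<le> f n" "0 \<le> g n" for n
    using a by (simp_all add: f_def g_def sum_nonneg)
  have FJ: "F \<subseteq> J" using N by (force simp: X_def J_def)
  have "(\<Sum>n\<in>F. (sum a {l n..u n} / card {l n..u n}) powr q)
      \<le> (\<Sum>n\<in>F. 2 powr q * (f n powr q + g n powr q))"
  proof (rule sum_mono)
    fix n assume n: "n \<in> F"
    then have eq: "l' n = l n" "u' n = u n"
      using N[of "l n"] N[of "u n"] by (auto simp: l'_def u'_def X_def)
    have "(sum a {l n..u n} / card {l n..u n}) powr q \<le> (f n + g n) powr q"
      using average_le_left_right[OF a lu[of n]] a q
      by (intro powr_mono2) (auto simp: f_def g_def eq sum_nonneg)
    also have "\<dots> \<le> (2 * max (f n) (g n)) powr q"
      using q fg0[of n] by (intro powr_mono2) auto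
    also have "\<dots> = 2 powr q * max (f n) (g n) powr q"
      using fg0[of n] by (simp add: powr_mult)
    also have "\<dots> \<le> 2 powr q * (f n powr q + g n powr q)"
      by (intro mult_left_mono) (auto simp: max_def)
    finally show "(sum a {l n..u n} / card {l n..u n}) powr q \<le> 2 powr q * (f n powr q + g n powr q)" .
  qed
  also have "\<dots> \<le> (\<Sum>n\<in>J. 2 powr q * (f n powr q + g n powr q))"
    using FJ by (intro sum_mono2) (auto simp: J_def)
  also have "\<dots> = 2 powr q * ((\<Sum>n\<in>J. f n powr q) + (\<Sum>n\<in>J. g n powr q))"
    by (simp add: sum.distrib flip: sum_distrib_left)
  also have "\<dots> \<le> 2 powr q * (c * (\<Sum>n\<in>J. a n powr q) + c * (\<Sum>n\<in>J. a n powr q))"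
    unfolding f_def g_def c_def J_def using lu
    by (intro mult_left_mono add_mono left_averages_strong_type right_averages_strong_type a q)
      (auto simp: l'_def u'_def)
  also have "\<dots> \<le> 2 powr q * (c * K + c * K)"
    by (intro mult_left_mono add_mono K) (auto simp: c_def J_def)
  finally show ?thesis by (simp add: c_def algebra_simps)
qed

section \<open>The modular: finite sums and scaling\<close>

text \<open>Translates between the extended-real infinite sum and the real finite sums in which all
  estimates are made.\<close>

lemma modular_le_iff:
  assumes "0 \<le> R"
  shows "modular p a \<le> ennreal R \<longleftrightarrow> (\<forall>F. finite F \<longrightarrow> (\<Sum>k\<in>F. \<bar>a k\<bar> powr p k) \<le> R)"
proof -
  have "modular p a = (SUP F\<in>{F. finite F}. \<Sum>k\<in>F. ennreal (\<bar>a k\<bar> powr p k))"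
    unfolding modular_def by (subst nonneg_infsum_complete) auto
  also have "\<dots> \<le> ennreal R \<longleftrightarrow> (\<forall>F. finite F \<longrightarrow> (\<Sum>k\<in>F. \<bar>a k\<bar> powr p k) \<le> R)"
    using assms by (simp add: SUP_le_iff sum_nonneg)
  finally show ?thesis .
qed

text \<open>Since \<open>R powr p k \<ge> R\<close>, each term shrinks at least by the factor
  \<open>R\<close>. This turns modular bounds into norm bounds.\<close>

lemma modular_scale_le_1:
  assumes p: "\<And>n. 1 \<le> p n" and R: "1 \<le> R" and le: "modular p a \<le> ennreal R"
  shows "modular p (\<lambda>k. a k / R) \<le> 1"
proof -
  have "(\<Sum>k\<in>F. \<bar>a k / R\<bar> powr p k) \<le> 1" if "finite F" for F
  proof -
    have "\<bar>a k / R\<bar> powr p k \<le> \<bar>a k\<bar> powr p k / R" for k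
    proof -
      have "R powr 1 \<le> R powr p k" using R p by (intro powr_mono) auto
      then have "\<bar>a k\<bar> powr p k / R powr p k \<le> \<bar>a k\<bar> powr p k / R"
        using R by (intro divide_left_mono) auto
      then show ?thesis using R by (simp add: abs_divide powr_divide)
    qed
    then have "(\<Sum>k\<in>F. \<bar>a k / R\<bar> powr p k) \<le> (\<Sum>k\<in>F. \<bar>a k\<bar> powr p k) / R"
      by (simp add: sum_divide_distrib sum_mono)
    also have "\<dots> \<le> 1"
      using le R that by (simp add: modular_le_iff)
    finally show ?thesis .
  qed
  then show ?thesis
    using modular_le_iff[of 1 p "\<lambda>k. a k / R"] by simp
qed

section \<open>Modular bound for averages over chosen intervals\<close>

text \<open>The bound in \<open>LH\<close> tends to 0, so \<open>q\<close> is the limit of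
  \<open>p\<close>. The log-Hoelder condition itself only gives \<open>q > 0\<close>, while the
  strong-type bound needs \<open>q > 1\<close>.\<close>

lemma LH_infinity_limit_ge:
  assumes C: "0 < C" and p: "\<And>n. r \<le> p n"
    and LH: "\<And>n. \<bar>p n - q\<bar> \<le> C / ln (exp 1 + \<bar>real_of_int n\<bar>)"
  shows "r \<le> q"
proof (rule ccontr)
  assume "\<not> r \<le> q"
  then have d: "0 < r - q" by simp
  obtain n :: nat where n: "exp (C / (r - q)) < real n" using reals_Archimedean2 by blast
  have "exp (C / (r - q)) < exp 1 + real n" using n by (simp add: add_strict_increasing)
  then have ln: "C / (r - q) < ln (exp 1 + real n)"
    by (metis add_pos_nonneg exp_gt_zero ln_exp ln_less_cancel_iff of_nat_0_le_iff)
  have pos: "0 < ln (exp 1 + real n)" using C d ln by (meson divide_pos_pos less_trans)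
  have "C / ln (exp 1 + real n) < r - q"
    using ln d pos by (simp add: field_simps)
  with LH[of "int n"] p[of "int n"] show False by simp
qed

text \<open>\<open>K\<close> is fixed before \<open>b\<close>, \<open>l\<close> and
  \<open>u\<close>, so the intervals may later be chosen depending on the sequence.\<close>

lemma averages_modular_bound:
  fixes p :: "int \<Rightarrow> real"
  assumes p: "\<And>n. r \<le> p n" and r: "1 < r" and C: "0 < C"
    and LH: "\<And>n. \<bar>p n - q\<bar> \<le> C / ln (exp 1 + \<bar>real_of_int n\<bar>)"
  obtains K where "1 \<le> K"
    "\<And>b l u. (\<And>k. 0 \<le> b k) \<Longrightarrow> modular p b \<le> 1 \<Longrightarrow> (\<And>n. l n \<le> n) \<Longrightarrow> (\<And>n. n \<le> u n)
      \<Longrightarrow> modular p (\<lambda>n. sum b {l n..u n} / card {l n..u n}) \<le> ennreal K"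
proof -
  have q: "1 < q" using LH_infinity_limit_ge[OF C p LH] r by simp
  obtain S where S: "0 \<le> S" "\<And>F. finite F \<Longrightarrow> (\<Sum>k\<in>F. (exp 1 + \<bar>real_of_int k\<bar>) powr - 2) \<le> S"
    by (rule sum_inverse_square_int_bounded) blast
  have y: "1 < exp 1 + \<bar>real_of_int k\<bar>" for k
    using exp_ge_add_one_self[of 1] by linarith
  define e where "e = exp (2 * C)"
  have e: "1 \<le> e" using C by (simp add: e_def)
  \<comment> \<open>Used twice: from \<open>p\<close> to \<open>q\<close> for \<open>b\<close>, and
    from \<open>q\<close> to \<open>p\<close> for the averages.\<close>
  have perturb: "(\<Sum>k\<in>F. x k powr s k) \<le> e * B + S"
    if "finite F" "\<And>k. 0 \<le> x k" "\<And>k. x k \<le> 1" "\<And>k. 1 \<le> s k"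
      "\<And>k. \<bar>v k - s k\<bar> \<le> C / ln (exp 1 + \<bar>real_of_int k\<bar>)"
      "(\<Sum>k\<in>F. x k powr v k) \<le> B" for F B and x s v :: "int \<Rightarrow> real"
  proof -
    have "(\<Sum>k\<in>F. x k powr s k)
        \<le> (\<Sum>k\<in>F. e * x k powr v k + (exp 1 + \<bar>real_of_int k\<bar>) powr - 2)"
      unfolding e_def by (intro sum_mono powr_le_exponent_perturbed that y)
    also have "\<dots> = e * (\<Sum>k\<in>F. x k powr v k) + (\<Sum>k\<in>F. (exp 1 + \<bar>real_of_int k\<bar>) powr - 2)"
      by (simp add: sum.distrib sum_distrib_left)
    also have "\<dots> \<le> e * B + S"
      using e that S by (intro add_mono mult_left_mono) auto
    finally show ?thesis .
  qed
  define D where "D = 4 * 2 powr q * (2 * (q / (q - 1))) powr q * (e * 1 + S)"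
  have D: "0 \<le> D" using e S by (simp add: D_def)
  \<comment> \<open>The \<open>max 1\<close> makes \<open>K\<close> admissible as a scaling factor
    in \<open>modular_scale_le_1\<close>.\<close>
  show ?thesis
  proof (rule that[of "max 1 (e * D + S)"])
    fix b :: "int \<Rightarrow> real" and l u :: "int \<Rightarrow> int"
    assume b: "\<And>k. 0 \<le> b k" and mod: "modular p b \<le> 1"
      and lu: "\<And>n. l n \<le> n" "\<And>n. n \<le> u n"
    have fin: "(\<Sum>k\<in>F. b k powr p k) \<le> 1" if "finite F" for F
      using mod modular_le_iff[of 1 p b] b that by simp
    have b1: "b k \<le> 1" for k
    proof (rule ccontr)
      assume "\<not> b k \<le> 1"
      then have "1 < b k powr p k" using p[of k] r by (intro gr_one_powr) auto
      with fin[of "{k}"] show False by simp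
    qed
    have bq: "(\<Sum>k\<in>G. b k powr q) \<le> e * 1 + S" if "finite G" for G
      using that b b1 q LH fin by (intro perturb[where v = p]) auto
    define c where "c n = sum b {l n..u n} / card {l n..u n}" for n
    have c0: "0 \<le> c n" for n using b by (simp add: c_def sum_nonneg)
    have c1: "c n \<le> 1" for n
    proof -
      have "sum b {l n..u n} \<le> real (card {l n..u n}) * 1"
        by (rule sum_bounded_above) (rule b1)
      then show ?thesis using order_trans[OF lu] by (simp add: c_def divide_le_eq)
    qed
    have "(\<Sum>n\<in>F. c n powr q) \<le> D" if "finite F" for F
      unfolding c_def D_def by (intro averages_strong_type b q that lu bq)
    then have "(\<Sum>n\<in>F. \<bar>c n\<bar> powr p n) \<le> e * D + S" if "finite F" for F
      using that c0 c1 LH p r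
      by (auto intro!: perturb[where v = "\<lambda>_. q"] simp: abs_minus_commute intro: less_imp_le[OF less_le_trans])
    then have "modular p c \<le> ennreal (max 1 (e * D + S))"
      by (subst modular_le_iff) (auto simp: le_max_iff_disj)
    then show "modular p (\<lambda>n. sum b {l n..u n} / card {l n..u n}) \<le> ennreal (max 1 (e * D + S))"
      by (simp add: c_def[abs_def])
  qed simp
qed

section \<open>Passage to the maximal operator and the norm\<close>

lemma modular_mono:
  assumes "\<And>k. \<bar>a k\<bar> \<le> \<bar>b k\<bar>" "\<And>k. 0 \<le> p k"
  shows "modular p a \<le> modular p b"
  unfolding modular_def
  by (intro infsum_mono nonneg_summable_on_complete ennreal_leI powr_mono2 assms) auto

text \<open>A nonzero supremum strictly exceeds its half, so some interval beats the half; if it is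
  zero, the singleton \<open>{n..n}\<close> does. This avoids the question of attainment at the cost
  of a factor 2.\<close>

lemma maximal_half_attained:
  assumes "p \<in> exponents" "a \<in> var_lp p"
  obtains l u where "l \<le> n" "n \<le> u" "maximal a n / 2 \<le> (\<Sum>k\<in>{l..u}. \<bar>a k\<bar>) / card {l..u}"
    "0 \<le> maximal a n"
proof -
  let ?f = "\<lambda>I. (\<Sum>k\<in>I. \<bar>a k\<bar>) / real (card I)"
  have n: "{n..n} \<in> intervals_around n" 
    unfolding intervals_around_def by (intro CollectI conjI exI[of _ n] refl) simp
  have "?f {n..n} \<le> maximal a n"
    unfolding maximal_def by (rule cSUP_upper[OF n var_lp_maximal_bdd_above[OF assms]])
  then have M: "\<bar>a n\<bar> \<le> maximal a n" by simp
  show ?thesis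
  proof (cases "maximal a n = 0")
    case True
    then show ?thesis using M by (intro that[of n n]) auto
  next
    case False
    then have "maximal a n / 2 < maximal a n" using M by auto
    then obtain I where "I \<in> intervals_around n" "maximal a n / 2 < ?f I"
      using n unfolding maximal_def[of a n]
      by (subst (asm) less_cSUP_iff) (auto intro: var_lp_maximal_bdd_above[OF assms])
    then obtain l u where "l \<le> n" "n \<le> u" "maximal a n / 2 < ?f {l..u}"
      by (auto simp: intervals_around_def)
    then show ?thesis
      using M by (intro that[of l u]) linarith+
  qed
qed

theorem theorem6p3:
  fixes p :: "int \<Rightarrow> real"
  assumes "p \<in> exponents"
    and "exp_plus p < \<infinity>"
    and "exp_minus p > 1"
    and "p \<in> LH_infinity"
  shows "\<exists>C::real. C > 0 \<and>
    (\<forall>a \<in> var_lp p. (\<forall>i. 0 \<le> a i) \<longrightarrow>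
       maximal a \<in> var_lp p \<and>
       var_lp_norm p (maximal a) \<le> C * var_lp_norm p a)"
proof -
  \<comment> \<open>A real number between 1 and \<open>exp_minus p\<close> replaces the
    extended-real infimum as a uniform lower bound.\<close>
  obtain r where r: "1 < ereal r" "ereal r < exp_minus p"
    using ereal_dense2[OF assms(3)] by auto
  have p: "r \<le> p n" for n
    using less_INF_D[OF r(2)[unfolded exp_minus_def], of n] by simp
  have r1: "1 < r" using r by (simp add: one_ereal_def)
  have p1: "1 \<le> p n" for n using p[of n] r1 by simp
  obtain C q where C: "0 < C" "\<And>n. \<bar>p n - q\<bar> \<le> C / ln (exp 1 + \<bar>real_of_int n\<bar>)"
    using assms(4) by (auto simp: LH_infinity_def)
  obtain K where K: "1 \<le> K"
    "\<And>b l u. (\<And>k. 0 \<le> b k) \<Longrightarrow> modular p b \<le> 1 \<Longrightarrow> (\<And>n. l n \<le> n) \<Longrightarrow> (\<And>n. n \<le> u n)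
      \<Longrightarrow> modular p (\<lambda>n. sum b {l n..u n} / card {l n..u n}) \<le> ennreal K"
    by (fact averages_modular_bound[OF p r1 C])
  have "maximal a \<in> var_lp p \<and> var_lp_norm p (maximal a) \<le> (2 * K) * var_lp_norm p a"
    if a: "a \<in> var_lp p" and a0: "\<forall>i. 0 \<le> a i" for a
  proof -
    define T where "T = {t. 0 < t \<and> modular p (\<lambda>k. a k / t) \<le> 1}"
    define T' where "T' = {t. 0 < t \<and> modular p (\<lambda>k. maximal a k / t) \<le> 1}"
    have abs: "(\<Sum>k\<in>I. \<bar>a k\<bar>) = sum a I" for I using a0 by simp
    have M0: "0 \<le> maximal a n" for n
      using maximal_half_attained[OF assms(1) a] by blast
    have "\<forall>n. \<exists>l u. l \<le> n \<and> n \<le> u \<and> maximal a n / 2 \<le> sum a {l..u} / card {l..u}"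
      using maximal_half_attained[OF assms(1) a] unfolding abs by blast
    then obtain l u where lu: "\<And>n. l n \<le> n" "\<And>n. n \<le> u n"
      and M: "\<And>n. maximal a n / 2 \<le> sum a {l n..u n} / card {l n..u n}"
      unfolding choice_iff by blast
    \<comment> \<open>The 2 pays for the near-optimal intervals, \<open>K\<close> for the modular
      bound, and \<open>t\<close> normalises \<open>a\<close>.\<close>
    have scale: "2 * K * t \<in> T'" if "t \<in> T" for t
    proof -
      have t: "0 < t" and mt: "modular p (\<lambda>k. a k / t) \<le> 1" using that by (auto simp: T_def)
      define c where "c n = (\<Sum>k\<in>{l n..u n}. a k / t) / card {l n..u n}" for n
      have "modular p c \<le> ennreal K"
        unfolding c_def[abs_def] using a0 t by (intro K mt lu) auto
      then have "modular p (\<lambda>n. c n / K) \<le> 1"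
        by (rule modular_scale_le_1[OF p1 K(1)])
      moreover have "modular p (\<lambda>n. maximal a n / (2 * K * t)) \<le> modular p (\<lambda>n. c n / K)"
      proof (rule modular_mono)
        fix n
        have "c n = sum a {l n..u n} / card {l n..u n} / t"
          by (simp add: c_def sum_divide_distrib[symmetric])
        then have "maximal a n / 2 / t \<le> c n"
          using divide_right_mono[OF M[of n], of t] t by (simp only: less_imp_le)
        then have "maximal a n / 2 / t / K \<le> c n / K"
          using K(1) by (intro divide_right_mono) auto
        then have "maximal a n / (2 * K * t) \<le> c n / K" by (simp add: mult_ac)
        moreover have "0 \<le> maximal a n / (2 * K * t)" using M0 K(1) t by simp
        ultimately show "\<bar>maximal a n / (2 * K * t)\<bar> \<le> \<bar>c n / K\<bar>" by linarith
      qed (use p1 in \<open>auto intro: order_trans[OF zero_le_one]\<close>)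
      ultimately show ?thesis using t K(1) by (auto simp: T'_def)
    qed
    \<comment> \<open>A finite modular at scale \<open>s\<close> becomes at most 1 at scale
      \<open>s * R\<close>. So \<open>T\<close> is nonempty, which makes its infimum meaningful and,
      through \<open>scale\<close>, gives membership of \<open>maximal a\<close>.\<close>
    obtain s where s: "0 < s" "modular p (\<lambda>k. a k / s) < \<infinity>" using a by (auto simp: var_lp_def)
    define R where "R = max 1 (enn2real (modular p (\<lambda>k. a k / s)))"
    have "modular p (\<lambda>k. a k / s) \<le> ennreal R"
      using s(2) unfolding R_def by (metis ennreal_enn2real ennreal_leI infinity_ennreal_def max.cobounded2)
    then have "modular p (\<lambda>k. a k / s / R) \<le> 1"
      by (intro modular_scale_le_1 p1) (simp_all add: R_def)
    then have sR: "s * R \<in> T"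
      using s(1) by (simp add: T_def R_def)
    have "2 * K * (s * R) \<in> T'" by (rule scale[OF sR])
    then have mem: "maximal a \<in> var_lp p"
      unfolding T'_def var_lp_def
      by (intro CollectI exI[of _ "2 * K * (s * R)"]) (auto intro: le_less_trans[of _ 1])
    have bdd: "bdd_below T'" unfolding T'_def by (rule bdd_belowI[of _ 0]) auto
    \<comment> \<open>By \<open>scale\<close>, the dilation of \<open>T\<close> by
      \<open>2 * K\<close> lies inside \<open>T'\<close>.\<close>
    have "Inf T' / (2 * K) \<le> Inf T"
    proof (rule cInf_greatest)
      show "T \<noteq> {}" using sR by blast
      fix t assume "t \<in> T"
      then have "Inf T' \<le> 2 * K * t" by (intro cInf_lower scale bdd)
      then show "Inf T' / (2 * K) \<le> t" using K(1) by (simp add: field_simps)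
    qed
    then have "Inf T' \<le> 2 * K * Inf T" using K(1) by (simp add: field_simps)
    with mem show ?thesis by (simp add: var_lp_norm_def T_def T'_def)
  qed
  then show ?thesis using K(1) by (intro exI[of _ "2 * K"]) auto
qed

end
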